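(* Let $\mathcal X$ be a $C^r$ vector field, $r\ge2$, near the origin of $\mathbb R^2$, with $\mathcal X(0)=0$ and $A:=D\mathcal X(0)$ satisfying $A\ne0$, $A^2=0$. Let $(q_0,q_1)$ and $(\widetilde q_0,\widetilde q_1)$ be Jordan chains of $A$ with $\widetilde q_0=aq_0$, $\widetilde q_1=aq_1+bq_0$, $a\neq0$, $b\in\mathbb R$, and write the associated distinguished restrictions as $$\mathcal R_{\mathcal X}(u)=\sum_{k=2}^r g_ku^k+o(u^r),\qquad \widetilde{\mathcal R}_{\mathcal X}(\widetilde u)=\sum_{k=2}^r\widetilde g_k\widetilde u^k+o(\widetilde u^r).$$ Then $$\widetilde g_k=a^{k-1}g_k,\qquad 2\le k\le r.$$ Consequently, within the available jet order, the vanishing or nonvanishing of each Taylor coefficient is independent of the chosen Jordan chain. If $\mathcal R_{\mathcal X}$ is analytic, in particular rational, near the origin, the same formula holds for every $k\ge2$.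
   Context: A Jordan chain of $A$ is a pair $(q_0,q_1)$ with $q_0\neq0$, $Aq_0=0$, $Aq_1=q_0$. Since $\ker A=\operatorname{im}A=\operatorname{span}\{q_0\}$, there is a unique scalar function $\mathcal R_{\mathcal X}$ near $0$ with $A\mathcal X(uq_0)=\mathcal R_{\mathcal X}(u)q_0$, called the distinguished restriction associated with the chain; it satisfies $\mathcal R_{\mathcal X}(0)=\mathcal R_{\mathcal X}'(0)=0$. *)

theory Defs
  imports "HOL-Analysis.Analysis" "HOL-Library.Landau_Symbols"
    "HOL-Computational_Algebra.Polynomial"
begin

text \<open>
  In finite dimension, continuity of all iterated directional derivatives (together with Frechet
  differentiability at each lower order) on an open set is the usual notion of being \<open>C\<^sup>k\<close>.
\<close>

primrec C_k_on :: "nat \<Rightarrow> ('a::real_normed_vector \<Rightarrow> 'b::real_normed_vector) \<Rightarrow> 'a set \<Rightarrow> bool"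
where
  "C_k_on 0 f S \<longleftrightarrow> continuous_on S f"
| "C_k_on (Suc k) f S \<longleftrightarrow>
     (\<forall>x\<in>S. f differentiable (at x)) \<and>
     (\<forall>v. C_k_on k (\<lambda>x. frechet_derivative f (at x) v) S)"

definition C_k_near :: "nat \<Rightarrow> ('a::real_normed_vector \<Rightarrow> 'b::real_normed_vector) \<Rightarrow> 'a \<Rightarrow> bool" where
  "C_k_near k f x \<longleftrightarrow> (\<exists>U. open U \<and> x \<in> U \<and> C_k_on k f U)"

definition jordan_chain :: "real^2^2 \<Rightarrow> real^2 \<Rightarrow> real^2 \<Rightarrow> bool" where
  "jordan_chain A q0 q1 \<longleftrightarrow> q0 \<noteq> 0 \<and> A *v q0 = 0 \<and> A *v q1 = q0"

text \<open>
  A vector field near the origin is represented by a total function, so the distinguished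
  restriction is total as well; only its germ at \<open>0\<close> is meaningful.  It depends on the chain only
  through \<open>q0\<close>.  Existence and uniqueness of the scalar are shown below.
\<close>

definition distinguished_restriction ::
  "real^2^2 \<Rightarrow> (real^2 \<Rightarrow> real^2) \<Rightarrow> real^2 \<Rightarrow> real \<Rightarrow> real" where
  "distinguished_restriction A X q0 u = (THE c. A *v X (u *\<^sub>R q0) = c *\<^sub>R q0)"

lemma jordan_chain_range:
  assumes "jordan_chain A q0 q1"
  shows "\<exists>!c. A *v x = c *\<^sub>R q0"
proof -
  have q0: "q0 \<noteq> 0" "A *v q0 = 0" "A *v q1 = q0"
    using assms by (auto simp: jordan_chain_def)
  have "q1 \<notin> span {q0}"
  proof
    assume "q1 \<in> span {q0}"
    then obtain c where "q1 = c *\<^sub>R q0" by (auto simp: span_singleton)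
    then have "A *v q1 = c *\<^sub>R (A *v q0)" by (simp add: matrix_vector_mult_scaleR)
    with q0 show False by simp
  qed
  then have ind: "independent {q1, q0}" and ne: "q1 \<noteq> q0"
    using q0 by (auto simp: independent_insert span_base)
  have "UNIV \<subseteq> span {q1, q0}"
    by (rule card_ge_dim_independent) (use ind ne in auto)
  then have "x \<in> span {q1, q0}" by blast
  then obtain \<beta> where "x - \<beta> *\<^sub>R q1 \<in> span {q0}" by (auto simp: span_insert)
  then obtain \<alpha> where "x - \<beta> *\<^sub>R q1 = \<alpha> *\<^sub>R q0" by (auto simp: span_singleton)
  then have "x = \<alpha> *\<^sub>R q0 + \<beta> *\<^sub>R q1" by (simp add: algebra_simps)
  then have "A *v x = \<beta> *\<^sub>R q0"
    using q0 by (simp add: matrix_vector_right_distrib matrix_vector_mult_scaleR)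
  then show ?thesis using q0 by auto
qed

lemma distinguished_restriction:
  assumes "jordan_chain A q0 q1"
  shows "A *v X (u *\<^sub>R q0) = distinguished_restriction A X q0 u *\<^sub>R q0"
  unfolding distinguished_restriction_def
  by (rule theI') (rule jordan_chain_range[OF assms])

lemma distinguished_restriction_unique:
  assumes "jordan_chain A q0 q1"
    and "\<forall>\<^sub>F u in nhds 0. A *v X (u *\<^sub>R q0) = R u *\<^sub>R q0"
  shows "\<forall>\<^sub>F u in nhds 0. R u = distinguished_restriction A X q0 u"
  using assms(2)
  by eventually_elim (use assms(1) distinguished_restriction in \<open>force simp: jordan_chain_def\<close>)

definition jet_expansion :: "nat \<Rightarrow> (real \<Rightarrow> real) \<Rightarrow> (nat \<Rightarrow> real) \<Rightarrow> bool" where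
  "jet_expansion r R g \<longleftrightarrow> (\<lambda>u. R u - (\<Sum>k=2..r. g k * u ^ k)) \<in> o[at 0](\<lambda>u. u ^ r)"

definition rational_near_0 :: "(real \<Rightarrow> real) \<Rightarrow> bool" where
  "rational_near_0 R \<longleftrightarrow>
     (\<exists>p q. poly q 0 \<noteq> 0 \<and> (\<forall>\<^sub>F u in nhds 0. R u = poly p u / poly q u))"

end

theory Submission
  imports Defs
begin

text \<open>
  Rescaling a Jordan chain only rescales the distinguished restriction: if \<open>q0' = a q0\<close>, then
  evaluating \<open>A X\<close> at \<open>u q0' = (a u) q0\<close> and comparing the multiples of \<open>q0\<close> and of \<open>q0'\<close>
  gives \<open>R' u = R (a u) / a\<close> for all \<open>u\<close> (lemma \<open>distinguished_restriction_scaleR\<close>).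
  Substituting \<open>a u\<close> for \<open>u\<close> in a finite jet, or in a power series, multiplies the \<open>k\<close>-th
  coefficient by \<open>a ^ k\<close>, and the division by \<open>a\<close> leaves the factor \<open>a ^ (k - 1)\<close>.  Since jets and
  power series are determined by the germ of the function, these are the only possible
  coefficients of \<open>R'\<close>.  The kernel of \<open>A\<close> is a line, so the first vectors of any two Jordan
  chains are proportional, and hence the vanishing of a coefficient does not depend on the chain.

  The existence of the jet needs Taylor's theorem with Peano remainder for the curve
  \<open>u \<mapsto> X (u q0)\<close> under the iterated-directional-derivative form of \<open>C\<^sup>r\<close>
  (lemma \<open>C_k_on_peano_expansion\<close>).  The coefficients of orders \<open>0\<close> and \<open>1\<close> vanish because
  \<open>X 0 = 0\<close> and because the derivative of \<open>u \<mapsto> A (X (u q0))\<close> at \<open>0\<close> is \<open>A (A q0) = 0\<close>.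
\<close>

section \<open>Polynomial expansions at the origin\<close>

lemma eventually_power_nonzero_at_0: "\<forall>\<^sub>F u::real in at 0. u ^ n \<noteq> 0"
  by (rule eventually_mono[OF eventually_neq_at_within[of 0 0 UNIV]]) simp

lemma power_in_smallo_at_0:
  assumes "m < n"
  shows "(\<lambda>u::real. u ^ n) \<in> o[at 0](\<lambda>u. u ^ m)"
proof (rule smalloI_tendsto)
  have "((\<lambda>u::real. u ^ (n - m)) \<longlongrightarrow> 0 ^ (n - m)) (at 0)"
    by (intro tendsto_intros)
  then have "((\<lambda>u::real. u ^ (n - m)) \<longlongrightarrow> 0) (at 0)"
    using assms by (simp add: power_0_left)
  moreover have "\<forall>\<^sub>F u::real in at 0. u ^ (n - m) = u ^ n / u ^ m"
    using assms by (auto simp: eventually_at_filter power_diff)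
  ultimately show "((\<lambda>u::real. u ^ n / u ^ m) \<longlongrightarrow> 0) (at 0)"
    by (rule Lim_transform_eventually)
qed (rule eventually_power_nonzero_at_0)

text \<open>
  Letting \<open>u\<close> tend to \<open>0\<close> isolates the constant coefficient; once it is known to vanish, dividing
  by \<open>u\<close> lowers the degree by one.
\<close>

lemma polynomial_smallo_imp_coeffs_zero:
  fixes d :: "nat \<Rightarrow> real"
  assumes "(\<lambda>u. \<Sum>k\<le>n. d k * u ^ k) \<in> o[at 0](\<lambda>u. u ^ n)" and "k \<le> n"
  shows "d k = 0"
  using assms
proof (induction n arbitrary: d k)
  case 0
  then have "(\<lambda>u::real. d 0) \<in> o[at 0](\<lambda>u. 1)" by simp
  from smalloD_tendsto[OF this] have "((\<lambda>u::real. d 0) \<longlongrightarrow> 0) (at 0)" by simp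
  then have "d 0 = 0" by (simp add: tendsto_const_iff)
  with 0 show ?case by simp
next
  case (Suc n)
  let ?p = "\<lambda>u::real. \<Sum>k\<le>Suc n. d k * u ^ k"
  have "?p \<in> o[at 0](\<lambda>u. u ^ 0)"
    by (rule landau_o.small_trans[OF Suc.prems(1)]) (rule power_in_smallo_at_0, simp)
  from smalloD_tendsto[OF this] have "(?p \<longlongrightarrow> 0) (at 0)" by simp
  moreover have "(?p \<longlongrightarrow> (\<Sum>k\<le>Suc n. d k * 0 ^ k)) (at 0)"
    by (intro tendsto_intros)
  ultimately have "(\<Sum>k\<le>Suc n. d k * 0 ^ k) = 0"
    using tendsto_unique[OF at_neq_bot] by blast
  then have d0: "d 0 = 0" by (simp add: sum.atMost_Suc_shift del: sum.atMost_Suc)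
  have "((\<lambda>u. ?p u / u ^ Suc n) \<longlongrightarrow> 0) (at 0)"
    by (rule smalloD_tendsto[OF Suc.prems(1)])
  moreover have "\<forall>\<^sub>F u::real in at 0.
      ?p u / u ^ Suc n = (\<Sum>k\<le>n. d (Suc k) * u ^ k) / u ^ n"
  proof -
    have "?p u = u * (\<Sum>k\<le>n. d (Suc k) * u ^ k)" for u :: real
      using d0 by (simp add: sum.atMost_Suc_shift sum_distrib_left mult_ac del: sum.atMost_Suc)
    then show ?thesis by (auto simp: eventually_at_filter)
  qed
  ultimately have "((\<lambda>u. (\<Sum>k\<le>n. d (Suc k) * u ^ k) / u ^ n) \<longlongrightarrow> 0) (at 0)"
    by (rule Lim_transform_eventually)
  then have "(\<lambda>u. \<Sum>k\<le>n. d (Suc k) * u ^ k) \<in> o[at 0](\<lambda>u. u ^ n)"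
    by (rule smalloI_tendsto[OF _ eventually_power_nonzero_at_0])
  from Suc.IH[OF this] d0 Suc.prems(2) show ?case by (cases k) auto
qed

lemma sum_atMost_eq_sum_from_2:
  fixes f :: "nat \<Rightarrow> 'a::comm_monoid_add"
  assumes "f 0 = 0" "f 1 = 0"
  shows "(\<Sum>k\<le>n. f k) = (\<Sum>k=2..n. f k)"
proof (rule sum.mono_neutral_right)
  show "\<forall>k\<in>{..n} - {2..n}. f k = 0"
  proof
    fix k assume "k \<in> {..n} - {2..n}"
    then have "k = 0 \<or> k = 1" by auto
    with assms show "f k = 0" by auto
  qed
qed auto

lemma jet_expansion_unique:
  assumes "jet_expansion r R g" "jet_expansion r R h" "2 \<le> k" "k \<le> r"
  shows "g k = h k"
proof -
  define d where "d k = (if k < 2 then 0 else g k - h k)" for k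
  have "(\<lambda>u. (R u - (\<Sum>k=2..r. h k * u ^ k)) - (R u - (\<Sum>k=2..r. g k * u ^ k)))
      \<in> o[at 0](\<lambda>u. u ^ r)"
    by (rule sum_in_smallo(2)[OF assms(2,1)[unfolded jet_expansion_def]])
  moreover have "(R u - (\<Sum>k=2..r. h k * u ^ k)) - (R u - (\<Sum>k=2..r. g k * u ^ k))
      = (\<Sum>k\<le>r. d k * u ^ k)" for u
  proof -
    have "(\<Sum>k\<le>r. d k * u ^ k) = (\<Sum>k=2..r. d k * u ^ k)"
      by (rule sum_atMost_eq_sum_from_2) (auto simp: d_def)
    also have "\<dots> = (\<Sum>k=2..r. g k * u ^ k - h k * u ^ k)"
      by (rule sum.cong) (auto simp: d_def algebra_simps)
    finally show ?thesis by (simp add: sum_subtractf)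
  qed
  ultimately have "(\<lambda>u. \<Sum>k\<le>r. d k * u ^ k) \<in> o[at 0](\<lambda>u. u ^ r)" by simp
  from polynomial_smallo_imp_coeffs_zero[OF this assms(4)] assms(3) show ?thesis
    by (simp add: d_def)
qed

lemma jet_expansion_rescale:
  assumes "jet_expansion r R g" "a \<noteq> 0"
  shows "jet_expansion r (\<lambda>u. R (a * u) / a) (\<lambda>k. a ^ (k - 1) * g k)"
proof -
  have "filterlim (\<lambda>u. a * u) (at 0) (at 0)"
    using assms(2) by (auto simp: filterlim_at eventually_at_filter intro!: tendsto_eq_intros)
  from landau_o.small.compose[OF assms(1)[unfolded jet_expansion_def] this]
  have "(\<lambda>u. R (a * u) - (\<Sum>k=2..r. g k * (a * u) ^ k)) \<in> o[at 0](\<lambda>u. (a * u) ^ r)" .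
  also have "(\<lambda>u. (a * u) ^ r) = (\<lambda>u. a ^ r * u ^ r)"
    by (simp add: power_mult_distrib)
  finally have "(\<lambda>u. inverse a * (R (a * u) - (\<Sum>k=2..r. g k * (a * u) ^ k)))
      \<in> o[at 0](\<lambda>u. u ^ r)"
    using assms(2) by simp
  moreover have "inverse a * (R (a * u) - (\<Sum>k=2..r. g k * (a * u) ^ k))
      = R (a * u) / a - (\<Sum>k=2..r. a ^ (k - 1) * g k * u ^ k)" for u
  proof -
    have "inverse a * (g k * (a * u) ^ k) = a ^ (k - 1) * g k * u ^ k" if "2 \<le> k" for k
      using that assms(2) by (cases k) (auto simp: power_mult_distrib)
    then have "(\<Sum>k=2..r. inverse a * (g k * (a * u) ^ k))
        = (\<Sum>k=2..r. a ^ (k - 1) * g k * u ^ k)"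
      by (intro sum.cong) auto
    then show ?thesis
      by (simp only: right_diff_distrib sum_distrib_left divide_inverse
          mult.commute[of _ "inverse a"])
  qed
  ultimately show ?thesis unfolding jet_expansion_def by simp
qed

section \<open>Taylor expansion along a line\<close>

text \<open>
  The mean value theorem turns a little-o bound on the derivative into one on the function, with
  one more power of \<open>u\<close>.
\<close>

lemma smallo_of_derivative_smallo:
  fixes h d :: "real \<Rightarrow> real"
  assumes deriv: "\<forall>\<^sub>F u in nhds 0. (h has_real_derivative d u) (at u)"
    and h0: "h 0 = 0"
    and small: "d \<in> o[at 0](\<lambda>u. u ^ n)"
  shows "h \<in> o[at 0](\<lambda>u. u ^ Suc n)"
proof (rule landau_o.smallI)
  fix c :: real assume "c > 0"
  from landau_o.smallD[OF small this]
  have "\<forall>\<^sub>F u in at 0. \<bar>d u\<bar> \<le> c * \<bar>u\<bar> ^ n" by (simp add: power_abs)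
  then obtain e1 where e1: "e1 > 0" "\<And>u. u \<noteq> 0 \<Longrightarrow> \<bar>u\<bar> < e1 \<Longrightarrow> \<bar>d u\<bar> \<le> c * \<bar>u\<bar> ^ n"
    unfolding eventually_at by (auto simp: dist_real_def)
  from deriv obtain e2 where e2: "e2 > 0"
    "\<And>u. \<bar>u\<bar> < e2 \<Longrightarrow> (h has_real_derivative d u) (at u)"
    unfolding eventually_nhds_metric by (auto simp: dist_real_def)
  have "\<bar>h u\<bar> \<le> c * \<bar>u ^ Suc n\<bar>" if "u \<noteq> 0" and less: "\<bar>u\<bar> < min e1 e2" for u
  proof -
    obtain z where z: "z \<noteq> 0" "\<bar>z\<bar> < \<bar>u\<bar>" "\<bar>h u\<bar> = \<bar>u\<bar> * \<bar>d z\<bar>"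
    proof (cases "u > 0")
      case True
      have "\<exists>z>0. z < u \<and> h u - h 0 = (u - 0) * d z"
        by (rule MVT2[OF True]) (use less in \<open>auto intro!: e2(2)\<close>)
      then obtain z where "0 < z" "z < u" "h u - h 0 = (u - 0) * d z" by blast
      with h0 show ?thesis by (intro that[of z]) (auto simp: abs_mult)
    next
      case False
      then have "u < 0" using \<open>u \<noteq> 0\<close> by simp
      have "\<exists>z>u. z < 0 \<and> h 0 - h u = (0 - u) * d z"
        by (rule MVT2[OF \<open>u < 0\<close>]) (use less in \<open>auto intro!: e2(2)\<close>)
      then obtain z where "u < z" "z < 0" "h 0 - h u = (0 - u) * d z" by blast
      with h0 show ?thesis by (intro that[of z]) (auto simp: abs_mult)
    qed
    have "\<bar>d z\<bar> \<le> c * \<bar>z\<bar> ^ n" using e1(2) z less by simp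
    also have "\<dots> \<le> c * \<bar>u\<bar> ^ n"
      using z \<open>c > 0\<close> by (intro mult_left_mono power_mono) auto
    finally have "\<bar>u\<bar> * \<bar>d z\<bar> \<le> \<bar>u\<bar> * (c * \<bar>u\<bar> ^ n)" by (rule mult_left_mono) simp
    with z show ?thesis by (simp add: abs_mult power_abs mult_ac)
  qed
  then show "\<forall>\<^sub>F u in at 0. norm (h u) \<le> c * norm (u ^ Suc n)"
    unfolding eventually_at using e1(1) e2(1)
    by (intro exI[of _ "min e1 e2"]) (auto simp: dist_real_def)
qed

text \<open>
  The derivative of \<open>u \<mapsto> L (f (u q))\<close> is \<open>u \<mapsto> L (D u)\<close> with \<open>D u\<close> the directional derivative of
  \<open>f\<close> at \<open>u q\<close> along \<open>q\<close>, a function of one order less of smoothness.  Integrating its expansion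
  term by term gives the expansion of the original function.  Keeping the functional \<open>L\<close> outside
  lets the induction run over \<open>f\<close> alone.
\<close>

lemma C_k_on_peano_expansion:
  fixes f :: "'a::real_normed_vector \<Rightarrow> 'b::real_normed_vector" and L :: "'b \<Rightarrow> real"
  assumes "bounded_linear L" "open U" "0 \<in> U" "C_k_on n f U"
  shows "\<exists>c. (\<lambda>u. L (f (u *\<^sub>R q)) - (\<Sum>k\<le>n. c k * u ^ k)) \<in> o[at 0](\<lambda>u. u ^ n)"
  using assms(4)
proof (induction n arbitrary: f)
  case 0
  interpret L: bounded_linear L by fact
  have "isCont (\<lambda>u. u *\<^sub>R q) 0" by (intro continuous_intros)
  moreover have "isCont f (0 *\<^sub>R q)"
    using 0 assms(2,3) by (simp add: continuous_on_eq_continuous_at)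
  ultimately have "isCont (\<lambda>u. f (u *\<^sub>R q)) 0" by (rule isCont_o2)
  then have "isCont (\<lambda>u. L (f (u *\<^sub>R q))) 0" by (rule L.isCont)
  then have "((\<lambda>u. L (f (u *\<^sub>R q)) - L (f 0)) \<longlongrightarrow> 0) (at 0)"
    by (simp add: isCont_def Lim_null[symmetric])
  then have "(\<lambda>u. L (f (u *\<^sub>R q)) - L (f 0)) \<in> o[at 0](\<lambda>u. 1)"
    by (intro smalloI_tendsto) auto
  then show ?case by (intro exI[of _ "\<lambda>_. L (f 0)"]) simp
next
  case (Suc n)
  interpret L: bounded_linear L by fact
  define D where "D u = L (frechet_derivative f (at (u *\<^sub>R q)) q)" for u
  from Suc.prems have "C_k_on n (\<lambda>x. frechet_derivative f (at x) q) U" by simp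
  from Suc.IH[OF this] obtain c
    where c: "(\<lambda>u. D u - (\<Sum>k\<le>n. c k * u ^ k)) \<in> o[at 0](\<lambda>u. u ^ n)"
    unfolding D_def by blast
  define c' where "c' k = (case k of 0 \<Rightarrow> L (f 0) | Suc j \<Rightarrow> c j / Suc j)" for k
  have "((\<lambda>u. u *\<^sub>R q) \<longlongrightarrow> 0 *\<^sub>R q) (nhds 0)"
    by (intro tendsto_intros filterlim_ident)
  then have "\<forall>\<^sub>F u in nhds 0. u *\<^sub>R q \<in> U"
    using assms(2,3) by (auto simp: tendsto_def)
  then have deriv: "\<forall>\<^sub>F u in nhds 0. ((\<lambda>u. L (f (u *\<^sub>R q)) - (\<Sum>k\<le>Suc n. c' k * u ^ k))
      has_real_derivative (D u - (\<Sum>k\<le>n. c k * u ^ k))) (at u)"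
  proof eventually_elim
    case (elim u)
    let ?f' = "frechet_derivative f (at (u *\<^sub>R q))"
    have f': "(f has_derivative ?f') (at (u *\<^sub>R q))"
      using elim Suc.prems by (simp add: frechet_derivative_works)
    have "((\<lambda>u. u *\<^sub>R q) has_derivative (\<lambda>h. h *\<^sub>R q)) (at u)"
      by (auto intro!: derivative_eq_intros)
    from has_derivative_compose[OF this f']
    have "((\<lambda>u. L (f (u *\<^sub>R q))) has_derivative (\<lambda>h. L (?f' (h *\<^sub>R q)))) (at u)"
      by (rule L.has_derivative)
    moreover have "L (?f' (h *\<^sub>R q)) = D u * h" for h
      using linear_cmul[OF has_derivative_linear[OF f'], of h q] by (simp add: D_def L.scaleR)
    ultimately have "((\<lambda>u. L (f (u *\<^sub>R q))) has_real_derivative D u) (at u)"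
      by (simp add: has_field_derivative_def)
    moreover have "((\<lambda>u. c' 0 + (\<Sum>k\<le>n. c' (Suc k) * u ^ Suc k))
        has_real_derivative (\<Sum>k\<le>n. c k * u ^ k)) (at u)"
    proof -
      have "((\<lambda>u. c' (Suc k) * u ^ Suc k) has_real_derivative c k * u ^ k) (at u)" for k
      proof -
        have "((\<lambda>u. c' (Suc k) * u ^ Suc k)
            has_real_derivative c' (Suc k) * (real (Suc k) * u ^ (Suc k - Suc 0))) (at u)"
          by (intro DERIV_cmult DERIV_pow)
        then show ?thesis by (simp add: c'_def field_simps del: of_nat_Suc power_Suc)
      qed
      then have "((\<lambda>u. c' 0 + (\<Sum>k\<le>n. c' (Suc k) * u ^ Suc k))
          has_real_derivative 0 + (\<Sum>k\<le>n. c k * u ^ k)) (at u)"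
        by (intro DERIV_add DERIV_const DERIV_sum)
      then show ?thesis by simp
    qed
    ultimately show ?case
      by (auto simp: sum.atMost_Suc_shift simp del: sum.atMost_Suc intro: DERIV_diff)
  qed
  have "(\<lambda>u. L (f (u *\<^sub>R q)) - (\<Sum>k\<le>Suc n. c' k * u ^ k)) \<in> o[at 0](\<lambda>u. u ^ Suc n)"
    by (rule smallo_of_derivative_smallo[OF deriv _ c])
      (simp add: c'_def sum.atMost_Suc_shift del: sum.atMost_Suc)
  then show ?case by blast
qed

section \<open>Real power series\<close>

text \<open>
  If a nonzero power series converged to the zero function, then shifting it by its subdegree
  would give a continuous function that vanishes away from \<open>0\<close> but not at \<open>0\<close>.
\<close>

lemma has_fps_expansion_zero_imp_zero:
  fixes F :: "'a::{banach, real_normed_field} fps"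
  assumes "(\<lambda>_. 0) has_fps_expansion F"
  shows "F = 0"
proof (rule ccontr)
  assume "F \<noteq> 0"
  define c where "c = fps_nth F (subdegree F)"
  have "c \<noteq> 0" using \<open>F \<noteq> 0\<close> by (simp add: c_def)
  have "(\<lambda>x. if x = 0 then c else 0 / x ^ subdegree F)
      has_fps_expansion fps_shift (subdegree F) F"
    by (rule has_fps_expansion_shift[OF assms]) (auto simp: c_def)
  from has_fps_expansion_imp_continuous[OF this, of UNIV]
  have "((\<lambda>x::'a. if x = 0 then c else 0) \<longlongrightarrow> c) (at 0)"
    by (simp add: continuous_within if_distrib cong: if_cong)
  moreover have "\<forall>\<^sub>F x::'a in at 0. (if x = 0 then c else 0) = 0"
    by (auto simp: eventually_at_filter)
  ultimately have "((\<lambda>x::'a. 0) \<longlongrightarrow> c) (at 0)"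
    by (rule Lim_transform_eventually)
  with \<open>c \<noteq> 0\<close> show False by (simp add: tendsto_const_iff)
qed

lemma has_fps_expansion_unique:
  fixes F G :: "'a::{banach, real_normed_field} fps"
  assumes "f has_fps_expansion F" "f has_fps_expansion G"
  shows "F = G"
  using has_fps_expansion_zero_imp_zero[of "F - G"] has_fps_expansion_diff[OF assms] by simp

lemma has_fps_expansion_rescale:
  fixes F :: "'a::{banach, real_normed_field} fps"
  assumes "f has_fps_expansion F" "a \<noteq> 0"
  shows "(\<lambda>x. f (a * x)) has_fps_expansion Abs_fps (\<lambda>n. a ^ n * fps_nth F n)"
    (is "_ has_fps_expansion ?G")
proof -
  have "fps_conv_radius ?G = fps_conv_radius F / ereal (norm a)"
    using assms(2) by (simp add: fps_conv_radius_def conv_radius_mult_power)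
  then have "fps_conv_radius ?G > 0"
    using assms by (simp add: has_fps_expansion_def ereal_less_divide_iff)
  moreover have "\<forall>\<^sub>F x in nhds 0. eval_fps F (a * x) = f (a * x)"
  proof -
    have "((\<lambda>x. a * x) \<longlongrightarrow> a * 0) (nhds 0)" by (intro tendsto_intros filterlim_ident)
    then have "filterlim (\<lambda>x. a * x) (nhds 0) (nhds 0)" by simp
    moreover have "\<forall>\<^sub>F x in nhds 0. eval_fps F x = f x"
      using assms(1) by (simp add: has_fps_expansion_def)
    ultimately show ?thesis by (rule eventually_compose_filterlim[rotated])
  qed
  moreover have "eval_fps ?G x = eval_fps F (a * x)" for x
    by (simp add: eval_fps_def power_mult_distrib mult_ac)
  ultimately show ?thesis by (simp add: has_fps_expansion_def)
qed

lemma rational_near_0_imp_has_fps_expansion: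
  assumes "rational_near_0 R"
  shows "\<exists>F. R has_fps_expansion F"
proof -
  obtain p q where q: "poly q 0 \<noteq> 0" and R: "\<forall>\<^sub>F u in nhds 0. R u = poly p u / poly q u"
    using assms by (auto simp: rational_near_0_def)
  have poly: "poly p has_fps_expansion fps_of_poly p" for p :: "real poly"
    by (simp add: has_fps_expansion_def)
  have "(\<lambda>u. poly p u / poly q u) has_fps_expansion fps_of_poly p / fps_of_poly q"
    by (rule has_fps_expansion_divide'[OF poly poly]) (use q in \<open>simp add: poly_0_coeff_0\<close>)
  with R have "R has_fps_expansion fps_of_poly p / fps_of_poly q"
    unfolding has_fps_expansion_def by (auto elim: eventually_elim2)
  then show ?thesis ..
qed

section \<open>Distinguished restrictions\<close>

lemma jordan_chains_proportional:
  assumes "jordan_chain A p0 p1" "jordan_chain A s0 s1"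
  obtains c where "c \<noteq> 0" "s0 = c *\<^sub>R p0"
proof -
  from jordan_chain_range[OF assms(1), of s1] obtain c where "A *v s1 = c *\<^sub>R p0" by blast
  with assms show ?thesis by (intro that[of c]) (auto simp: jordan_chain_def)
qed

text \<open>
  Both sides are the coordinate of the same vector \<open>A (X (u a q0))\<close>, once with respect to
  \<open>a q0\<close> and once with respect to \<open>q0\<close>.
\<close>

lemma distinguished_restriction_scaleR:
  assumes "jordan_chain A q0 q1" "a \<noteq> 0"
  shows "distinguished_restriction A X (a *\<^sub>R q0)
    = (\<lambda>u. distinguished_restriction A X q0 (a * u) / a)"
proof
  fix u
  have "jordan_chain A (a *\<^sub>R q0) (a *\<^sub>R q1)"
    using assms by (simp add: jordan_chain_def matrix_vector_mult_scaleR)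
  from distinguished_restriction[OF this, of X u]
    distinguished_restriction[OF assms(1), of X "a * u"]
  have "(distinguished_restriction A X (a *\<^sub>R q0) u * a) *\<^sub>R q0
      = distinguished_restriction A X q0 (a * u) *\<^sub>R q0"
    unfolding scaleR_scaleR mult.commute[of u a] by (rule trans[OF sym])
  then have "distinguished_restriction A X (a *\<^sub>R q0) u * a
      = distinguished_restriction A X q0 (a * u)"
    using assms(1) by (simp add: jordan_chain_def)
  with assms(2) show "distinguished_restriction A X (a *\<^sub>R q0) u
      = distinguished_restriction A X q0 (a * u) / a"
    by (simp add: eq_divide_eq)
qed

lemma distinguished_restriction_eq_inner:
  assumes "jordan_chain A q0 q1"
  shows "distinguished_restriction A X q0 u = (A *v X (u *\<^sub>R q0)) \<bullet> q0 / (q0 \<bullet> q0)"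
  using assms distinguished_restriction[OF assms, of X u] by (simp add: jordan_chain_def)

lemma distinguished_restriction_jet_exists:
  assumes Cr: "C_k_near r X 0" and X0: "X 0 = 0"
    and A: "(X has_derivative (\<lambda>v. A *v v)) (at 0)"
    and chain: "jordan_chain A q0 q1"
    and r: "r \<ge> 1"
  shows "\<exists>g. jet_expansion r (distinguished_restriction A X q0) g"
proof -
  define R where "R = distinguished_restriction A X q0"
  define L where "L x = (A *v x) \<bullet> q0 / (q0 \<bullet> q0)" for x
  have R_eq: "R u = L (X (u *\<^sub>R q0))" for u
    by (simp add: R_def L_def distinguished_restriction_eq_inner[OF chain])
  have L: "bounded_linear L"
    unfolding L_def divide_inverse
    by (intro bounded_linear_mult_const bounded_linear_inner_left_comp
        matrix_vector_mul_bounded_linear)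
  from Cr obtain U where "open U" "0 \<in> U" "C_k_on r X U"
    by (auto simp: C_k_near_def)
  from C_k_on_peano_expansion[OF L this, of q0] obtain c
    where c: "(\<lambda>u. R u - (\<Sum>k\<le>r. c k * u ^ k)) \<in> o[at 0](\<lambda>u. u ^ r)"
    by (auto simp: R_eq)
  \<comment> \<open>The linear part of \<open>R\<close> vanishes since \<open>A\<close> kills \<open>A q0\<close>, so \<open>R u\<close> is \<open>o(u)\<close>.\<close>
  have "((\<lambda>u. u *\<^sub>R q0) has_derivative (\<lambda>h. h *\<^sub>R q0)) (at 0)"
    by (auto intro!: derivative_eq_intros)
  from has_derivative_compose[OF this, of X "\<lambda>v. A *v v"] A
  have "((\<lambda>u. X (u *\<^sub>R q0)) has_derivative (\<lambda>h. A *v (h *\<^sub>R q0))) (at 0)" by simp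
  from bounded_linear.has_derivative[OF L this]
  have "(R has_derivative (\<lambda>h. L (A *v (h *\<^sub>R q0)))) (at 0)" by (simp add: R_eq[abs_def])
  moreover have "L (A *v (h *\<^sub>R q0)) = 0" for h
    using chain by (simp add: L_def jordan_chain_def matrix_vector_mult_scaleR)
  ultimately have "(R has_real_derivative 0) (at 0)"
    by (simp add: has_field_derivative_def lambda_zero)
  moreover have "R 0 = 0" by (simp add: R_eq X0 L_def)
  ultimately have "((\<lambda>u. R u / u ^ 1) \<longlongrightarrow> 0) (at 0)" by (simp add: DERIV_def)
  then have R_small: "R \<in> o[at 0](\<lambda>u. u ^ 1)"
    by (rule smalloI_tendsto[OF _ eventually_power_nonzero_at_0])
  have "(\<lambda>u. R u - (\<Sum>k\<le>r. c k * u ^ k)) \<in> o[at 0](\<lambda>u. u ^ 1)"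
  proof (cases "r = 1")
    case False
    with r show ?thesis by (intro landau_o.small_trans[OF c] power_in_smallo_at_0) simp
  qed (use c in simp)
  moreover have "(\<lambda>u. \<Sum>k=2..r. c k * u ^ k) \<in> o[at 0](\<lambda>u. u ^ 1)"
  proof (rule big_sum_in_smallo)
    fix k assume "k \<in> {2..r}"
    then have "(\<lambda>u::real. u ^ k) \<in> o[at 0](\<lambda>u. u ^ 1)" by (intro power_in_smallo_at_0) auto
    then show "(\<lambda>u. c k * u ^ k) \<in> o[at 0](\<lambda>u. u ^ 1)" by simp
  qed
  ultimately have "(\<lambda>u. R u - (R u - (\<Sum>k\<le>r. c k * u ^ k)) - (\<Sum>k=2..r. c k * u ^ k))
      \<in> o[at 0](\<lambda>u. u ^ 1)"
    by (intro sum_in_smallo(2)[OF sum_in_smallo(2)[OF R_small]])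
  moreover have "R u - (R u - (\<Sum>k\<le>r. c k * u ^ k)) - (\<Sum>k=2..r. c k * u ^ k)
      = (\<Sum>k\<le>1. c k * u ^ k)" for u
  proof -
    have "{..r} = {..1} \<union> {2..r}" using r by auto
    then show ?thesis by (simp only:) (subst sum.union_disjoint, auto)
  qed
  ultimately have lin: "(\<lambda>u. \<Sum>k\<le>1. c k * u ^ k) \<in> o[at 0](\<lambda>u. u ^ 1)" by simp
  have "c 0 = 0" "c 1 = 0"
    using polynomial_smallo_imp_coeffs_zero[OF lin] by auto
  then have "(\<Sum>k\<le>r. c k * u ^ k) = (\<Sum>k=2..r. c k * u ^ k)" for u
    by (intro sum_atMost_eq_sum_from_2) auto
  with c have "jet_expansion r R c" by (simp add: jet_expansion_def)
  then show ?thesis unfolding R_def by blast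
qed

theorem corollary3p3:
  fixes X :: "real^2 \<Rightarrow> real^2" and A :: "real^2^2"
    and q0 q1 q0' q1' :: "real^2" and a b :: real and r :: nat
    and R R' :: "real \<Rightarrow> real"
  assumes r: "r \<ge> 2"
    and Cr: "C_k_near r X 0"
    and X0: "X 0 = 0"
    and A: "(X has_derivative (\<lambda>v. A *v v)) (at 0)"
    and A_ne: "A \<noteq> 0"
    and A_nilp: "A ** A = 0"
    and chain: "jordan_chain A q0 q1"
    and chain': "jordan_chain A q0' q1'"
    and q0': "q0' = a *\<^sub>R q0"
    and q1': "q1' = a *\<^sub>R q1 + b *\<^sub>R q0"
    and a: "a \<noteq> 0"
    and R: "R = distinguished_restriction A X q0"
    and R': "R' = distinguished_restriction A X q0'"
  shows "(\<exists>g. jet_expansion r R g) \<and> (\<exists>g'. jet_expansion r R' g')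
    \<and> (\<forall>g g'. jet_expansion r R g \<longrightarrow> jet_expansion r R' g' \<longrightarrow>
          (\<forall>k. 2 \<le> k \<and> k \<le> r \<longrightarrow> g' k = a ^ (k - 1) * g k))
    \<and> (\<forall>p0 p1 s0 s1 g h. jordan_chain A p0 p1 \<longrightarrow> jordan_chain A s0 s1 \<longrightarrow>
          jet_expansion r (distinguished_restriction A X p0) g \<longrightarrow>
          jet_expansion r (distinguished_restriction A X s0) h \<longrightarrow>
          (\<forall>k. 2 \<le> k \<and> k \<le> r \<longrightarrow> (g k = 0 \<longleftrightarrow> h k = 0)))
    \<and> (\<forall>F. R has_fps_expansion F \<longrightarrow>
          (\<exists>F'. R' has_fps_expansion F') \<and>
          (\<forall>F'. R' has_fps_expansion F' \<longrightarrow>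
             (\<forall>k\<ge>2. fps_nth F' k = a ^ (k - 1) * fps_nth F k)))
    \<and> (rational_near_0 R \<longrightarrow> (\<exists>F. R has_fps_expansion F))"
proof (intro conjI allI impI)
  have R'_eq: "R' = (\<lambda>u. R (a * u) / a)"
    unfolding R R' q0' by (rule distinguished_restriction_scaleR[OF chain a])
  show jet: "\<exists>g. jet_expansion r R g"
    unfolding R using r by (intro distinguished_restriction_jet_exists[OF Cr X0 A chain]) simp
  then show "\<exists>g'. jet_expansion r R' g'"
    unfolding R'_eq using jet_expansion_rescale[OF _ a] by blast
  show "g' k = a ^ (k - 1) * g k"
    if "jet_expansion r R g" "jet_expansion r R' g'" "2 \<le> k \<and> k \<le> r" for g g' k
    using jet_expansion_unique[OF that(2), of _ k] jet_expansion_rescale[OF that(1) a] that(3)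
    by (simp add: R'_eq)
  show "g k = 0 \<longleftrightarrow> h k = 0"
    if p: "jordan_chain A p0 p1" and s: "jordan_chain A s0 s1"
      and g: "jet_expansion r (distinguished_restriction A X p0) g"
      and h: "jet_expansion r (distinguished_restriction A X s0) h"
      and k: "2 \<le> k \<and> k \<le> r" for p0 p1 s0 s1 g h k
  proof -
    obtain c where c: "c \<noteq> 0" "s0 = c *\<^sub>R p0"
      by (rule jordan_chains_proportional[OF p s])
    have "jet_expansion r (distinguished_restriction A X s0) (\<lambda>k. c ^ (k - 1) * g k)"
      unfolding c(2) distinguished_restriction_scaleR[OF p c(1)]
      by (rule jet_expansion_rescale[OF g c(1)])
    from jet_expansion_unique[OF h this] k have "h k = c ^ (k - 1) * g k" by simp
    with c(1) show ?thesis by simp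
  qed
  have expansion: "R' has_fps_expansion fps_const (inverse a) * Abs_fps (\<lambda>n. a ^ n * fps_nth F n)"
    if "R has_fps_expansion F" for F
  proof -
    have "(\<lambda>u. inverse a * R (a * u)) has_fps_expansion
        fps_const (inverse a) * Abs_fps (\<lambda>n. a ^ n * fps_nth F n)"
      by (intro has_fps_expansion_cmult_left has_fps_expansion_rescale[OF that a])
    then show ?thesis by (simp add: R'_eq divide_inverse mult.commute)
  qed
  then show "\<exists>F'. R' has_fps_expansion F'" if "R has_fps_expansion F" for F
    using that by blast
  show "fps_nth F' k = a ^ (k - 1) * fps_nth F k"
    if "R has_fps_expansion F" "R' has_fps_expansion F'" "2 \<le> k" for F F' k
  proof -
    have "F' = fps_const (inverse a) * Abs_fps (\<lambda>n. a ^ n * fps_nth F n)"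
      by (rule has_fps_expansion_unique[OF that(2) expansion[OF that(1)]])
    with a \<open>2 \<le> k\<close> show ?thesis by (cases k) auto
  qed
  show "\<exists>F. R has_fps_expansion F" if "rational_near_0 R"
    by (rule rational_near_0_imp_has_fps_expansion[OF that])
qed

end
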